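(* Let $\mathcal{M}=\langle S,S_0,T,A,H\rangle$ be the transition system of a Boolean evolution system, let $g_1\to a$ and $g_2\to\neg a$ be two of its rules, and let $next_0,next_1,\dots$ be the sets of states produced by the modified state space generation. Assume that some state reachable from $S_0$ enables both rules. Then a shortest trace leading from an initial state to an inconsistent state enabling the rules $g_1\to a$ and $g_2\to\neg a$ is obtained by the following steps. 1. Starting from $i=0$, test each $next_i$ to find the smallest index $k$ such that $next_k\cap g_1\cap g_2\neq\emptyset$ (where $g_j$ also denotes the set of states satisfying $g_j$). 2. Pick an arbitrary state $s_k\in next_k\cap g_1\cap g_2$; pick an arbitrary predecessor $s_{k-1}$ of $s_k$ (with respect to $T$) in $next_{k-1}$; in the same way pick an arbitrary predecessor $s_{k-2}$ of $s_{k-1}$ in $next_{k-2}$; continue until a state $s_0\in next_0=S_0$ is found. That is, such $k$ exists, the choices in step 2 are always possible, and the resulting sequence $s_0s_1\cdots s_k$ is a path of $\mathcal{M}$ from an initial state to a state enabling both rules, of minimal length among all such paths.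
   Context: A Boolean evolution system $BES=\langle\mathcal{B},\mathcal{R}\rangle$ consists of a finite set of variables $\mathcal{B}=\{b_1,\dots,b_n\}$, $n=n_1+n_2$, with $\mathcal{B}^{unknown}=\{b_1,\dots,b_{n_1}\}$ and $\mathcal{B}^{known}=\{b_{n_1+1},\dots,b_{n_1+n_2}\}$, and a finite set $\mathcal{R}$ of rules, each of the form $g\to b$ (assign $true$ to $b$) or $g\to\neg b$ (assign $false$ to $b$), where $g$ (the guard) is a Boolean formula over $\mathcal{B}$ and $b\in\mathcal{B}$. A valuation gives each known variable a value in $\{true,false\}$ and each unknown variable a value in $\{true,false,unknown\}$. Guards are evaluated to $true$, $false$ or $unknown$ (strong Kleene three-valued logic); a state satisfies $g$ if $g$ evaluates to $true$, and then a rule with guard $g$ is enabled. It is assumed that at each valuation the set of enabled rules is non-empty. The transition system $\mathcal{M}=\langle S,S_0,T,A,H\rangle$ of $BES$: $S$ is the set of all valuations; $S_0$ is the set of valuations in which all unknown variables have value $unknown$; $(s,s')\in T$ iff $s'$ results from $s$ by simultaneously applying all enabled rules: $s'(b)=s(b)$ if no enabled rule assigns $b$; $s'(b)=true$ (resp. $false$) if some enabled rule is of the form $g\to b$ (resp. $g\to\neg b$) and none assigns the opposite value; if enabled rules of both forms exist for $b$, $s'(b)$ may be either value. For $\overline{S}\subseteq S$, $Image(\overline{S},T)=\{s\in S\mid\exists s'\in\overline{S},\ (s',s)\in T\}$. Modified state space generation: initialise $S^\ast:=\emptyset$, $next_0:=S_0$, $q:=S_0$, $i:=0$; while $S^\ast\neq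 q$, do $i:=i+1$; $S^\ast:=q$; $next_i:=Image(next_{i-1},T)\setminus S^\ast$; $q:=S^\ast\cup next_i$. It returns the set $S^\ast$ of reachable states and $next_0,\dots,next_i$. *)

theory Defs
  imports Main "HOL-Library.FuncSet" "HOL-Library.While_Combinator"
begin

datatype tval = TTrue | TFalse | TUnknown

fun tval_of_bool :: "bool \<Rightarrow> tval" where
  "tval_of_bool True = TTrue"
| "tval_of_bool False = TFalse"

datatype 'v bform =
    BConst bool
  | BVar 'v
  | BNot "'v bform"
  | BAnd "'v bform" "'v bform"
  | BOr "'v bform" "'v bform"

fun bvars :: "'v bform \<Rightarrow> 'v set" where
  "bvars (BConst c) = {}"
| "bvars (BVar b) = {b}"
| "bvars (BNot g) = bvars g"
| "bvars (BAnd g h) = bvars g \<union> bvars h"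
| "bvars (BOr g h) = bvars g \<union> bvars h"

text \<open>Strong Kleene connectives.\<close>

fun kleene_not :: "tval \<Rightarrow> tval" where
  "kleene_not TTrue = TFalse"
| "kleene_not TFalse = TTrue"
| "kleene_not TUnknown = TUnknown"

fun kleene_and :: "tval \<Rightarrow> tval \<Rightarrow> tval" where
  "kleene_and TTrue TTrue = TTrue"
| "kleene_and TFalse _ = TFalse"
| "kleene_and _ TFalse = TFalse"
| "kleene_and _ _ = TUnknown"

fun kleene_or :: "tval \<Rightarrow> tval \<Rightarrow> tval" where
  "kleene_or TFalse TFalse = TFalse"
| "kleene_or TTrue _ = TTrue"
| "kleene_or _ TTrue = TTrue"
| "kleene_or _ _ = TUnknown"

type_synonym 'v valuation = "'v \<Rightarrow> tval"

fun beval :: "'v valuation \<Rightarrow> 'v bform \<Rightarrow> tval" where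
  "beval s (BConst c) = tval_of_bool c"
| "beval s (BVar b) = s b"
| "beval s (BNot g) = kleene_not (beval s g)"
| "beval s (BAnd g h) = kleene_and (beval s g) (beval s h)"
| "beval s (BOr g h) = kleene_or (beval s g) (beval s h)"

text \<open>\<open>Rule g b True\<close> is the rule \<open>g \<rightarrow> b\<close>, and \<open>Rule g b False\<close> is the rule
  \<open>g \<rightarrow> \<not> b\<close>.\<close>

datatype 'v bes_rule = Rule (guard: "'v bform") (target: 'v) (assigned: bool)

record 'v bes =
  unknown_vars :: "'v set"
  known_vars :: "'v set"
  bes_rules :: "'v bes_rule set"

definition bes_vars :: "'v bes \<Rightarrow> 'v set" where
  "bes_vars E = unknown_vars E \<union> known_vars E"

text \<open>Valuations are made \<^const>\<open>undefined\<close> outside the variables of the system, so that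
  equality of functions is equality of valuations.\<close>

definition valuations :: "'v bes \<Rightarrow> 'v valuation set" where
  "valuations E =
    (\<Pi>\<^sub>E b\<in>bes_vars E. if b \<in> known_vars E then {TTrue, TFalse} else {TTrue, TFalse, TUnknown})"

definition enabled_rules :: "'v bes \<Rightarrow> 'v valuation \<Rightarrow> 'v bes_rule set" where
  "enabled_rules E s = {r \<in> bes_rules E. beval s (guard r) = TTrue}"

definition boolean_evolution_system :: "'v bes \<Rightarrow> bool" where
  "boolean_evolution_system E \<longleftrightarrow>
     finite (unknown_vars E) \<and> finite (known_vars E) \<and>
     unknown_vars E \<inter> known_vars E = {} \<and>
     finite (bes_rules E) \<and>
     (\<forall>r\<in>bes_rules E. bvars (guard r) \<subseteq> bes_vars E \<and> target r \<in> bes_vars E) \<and>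
     (\<forall>s\<in>valuations E. enabled_rules E s \<noteq> {})"

definition assigns :: "'v bes \<Rightarrow> 'v valuation \<Rightarrow> 'v \<Rightarrow> bool \<Rightarrow> bool" where
  "assigns E s b v \<longleftrightarrow> (\<exists>r\<in>enabled_rules E s. target r = b \<and> assigned r = v)"

definition bes_transitions :: "'v bes \<Rightarrow> ('v valuation \<times> 'v valuation) set" where
  "bes_transitions E =
    {(s, s'). s \<in> valuations E \<and> s' \<in> valuations E \<and>
       (\<forall>b\<in>bes_vars E.
          if assigns E s b True \<and> assigns E s b False then s' b \<in> {TTrue, TFalse}
          else if assigns E s b True then s' b = TTrue
          else if assigns E s b False then s' b = TFalse
          else s' b = s b)}"

text \<open>The components of a tuple \<open>\<langle>S, S\<^sub>0, T, A, H\<rangle>\<close>, in this order.\<close>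

record ('s, 'p) transition_system =
  states :: "'s set"
  inits :: "'s set"
  trel :: "('s \<times> 's) set"
  atoms :: "'p set"
  labelling :: "'s \<Rightarrow> 'p set"

text \<open>The atomic propositions and the labelling are left arbitrary.\<close>

definition transition_system_of ::
  "'v bes \<Rightarrow> ('v valuation, 'p) transition_system \<Rightarrow> bool" where
  "transition_system_of E M \<longleftrightarrow>
     states M = valuations E \<and>
     inits M = {s \<in> valuations E. \<forall>b\<in>unknown_vars E. s b = TUnknown} \<and>
     trel M = bes_transitions E"

definition sat_states ::
  "('v valuation, 'p) transition_system \<Rightarrow> 'v bform \<Rightarrow> 'v valuation set" where
  "sat_states M g = {s \<in> states M. beval s g = TTrue}"

definition post_image :: "('s, 'p) transition_system \<Rightarrow> 's set \<Rightarrow> 's set" where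
  "post_image M X = {s \<in> states M. \<exists>s'\<in>X. (s', s) \<in> trel M}"

text \<open>The loop state is \<open>(S\<^sup>*, next, q, i)\<close>, where \<open>next\<close> is only meaningful at indices up to \<open>i\<close>.
  The result is \<^const>\<open>None\<close> if the loop does not terminate, and otherwise consists of the final
  values of \<open>S\<^sup>*\<close>, \<open>next\<close> and \<open>i\<close>.\<close>

definition state_space_generation ::
  "('s, 'p) transition_system \<Rightarrow> ('s set \<times> (nat \<Rightarrow> 's set) \<times> nat) option" where
  "state_space_generation M =
     map_option (\<lambda>(Sstar, nxt, q, i). (Sstar, nxt, i))
       (while_option
          (\<lambda>(Sstar, nxt, q, i). Sstar \<noteq> q)
          (\<lambda>(Sstar, nxt, q, i).
             let i' = i + 1;
                 Sstar' = q;
                 nxt' = nxt(i' := post_image M (nxt (i' - 1)) - Sstar');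
                 q' = Sstar' \<union> nxt' i'
             in (Sstar', nxt', q', i'))
          ({}, (\<lambda>_. undefined)(0 := inits M), inits M, 0))"

text \<open>\<open>backward_choice M nxt G k j xs\<close>: choosing backwards from index \<open>k\<close> has produced the states
  \<open>xs = [s\<^sub>j, \<dots>, s\<^sub>k]\<close>, starting with some \<open>s\<^sub>k\<close> in \<open>nxt k \<inter> G\<close>.\<close>

inductive backward_choice ::
  "('s, 'p) transition_system \<Rightarrow> (nat \<Rightarrow> 's set) \<Rightarrow> 's set \<Rightarrow> nat \<Rightarrow> nat \<Rightarrow> 's list \<Rightarrow> bool"
  for M nxt G k where
  pick_last: "s \<in> nxt k \<inter> G \<Longrightarrow> backward_choice M nxt G k k [s]"
| pick_pred: "\<lbrakk>backward_choice M nxt G k (Suc j) (s # xs); s' \<in> nxt j; (s', s) \<in> trel M\<rbrakk>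
    \<Longrightarrow> backward_choice M nxt G k j (s' # s # xs)"

definition trace_to :: "('s, 'p) transition_system \<Rightarrow> 's set \<Rightarrow> 's list \<Rightarrow> bool" where
  "trace_to M G xs \<longleftrightarrow>
     xs \<noteq> [] \<and> set xs \<subseteq> states M \<and> hd xs \<in> inits M \<and> last xs \<in> G \<and>
     successively (\<lambda>s s'. (s, s') \<in> trel M) xs"

definition shortest_trace_to :: "('s, 'p) transition_system \<Rightarrow> 's set \<Rightarrow> 's list \<Rightarrow> bool" where
  "shortest_trace_to M G xs \<longleftrightarrow>
     trace_to M G xs \<and> (\<forall>ys. trace_to M G ys \<longrightarrow> length xs \<le> length ys)"

end

theory Submission imports Defs begin

text \<open>The set \<open>next\<^sub>n\<close> consists of the states at distance exactly \<open>n\<close> from the initial states.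
  Hence the first \<open>next\<^sub>k\<close> that meets a target set realises the distance to this set, and every
  state of \<open>next\<^sub>n\<^sub>+\<^sub>1\<close> is by construction an image of a state of \<open>next\<^sub>n\<close>, so the backward choices
  never get stuck.\<close>

text \<open>Walks may revisit states, so one state can lie in several of these sets. As iterates of
  a single operator they suit induction.\<close>

definition reach_in :: "('s, 'p) transition_system \<Rightarrow> nat \<Rightarrow> 's set" where
  "reach_in M n = (post_image M ^^ n) (inits M)"

text \<open>A loop-free form of the sets \<open>next\<close>, to which the loop invariant ties the
  computed values.\<close>

definition layer :: "('s, 'p) transition_system \<Rightarrow> nat \<Rightarrow> 's set" where
  "layer M n = reach_in M n - (\<Union>j<n. reach_in M j)"

lemma reach_in_0 [simp]: "reach_in M 0 = inits M"
  by (simp add: reach_in_def)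

lemma reach_in_Suc: "reach_in M (Suc n) = post_image M (reach_in M n)"
  by (simp add: reach_in_def)

lemma post_image_mono: "X \<subseteq> Y \<Longrightarrow> post_image M X \<subseteq> post_image M Y"
  by (auto simp: post_image_def)

lemma post_image_UN: "post_image M (\<Union>j\<in>J. X j) = (\<Union>j\<in>J. post_image M (X j))"
  by (auto simp: post_image_def)

lemma reach_in_subset_states:
  assumes "inits M \<subseteq> states M"
  shows "reach_in M n \<subseteq> states M"
  using assms by (cases n) (auto simp: reach_in_Suc post_image_def)

lemma layer_0 [simp]: "layer M 0 = inits M"
  by (simp add: layer_def)

text \<open>Expanding only the newest layer loses nothing: if a predecessor of \<open>s\<close> were
  reached at some step \<open>j < n\<close>, then \<open>s\<close> would be reached at step
  \<open>Suc j \<le> n\<close> and would not be new.\<close>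

lemma layer_Suc: "layer M (Suc n) = post_image M (layer M n) - (\<Union>j\<le>n. reach_in M j)"
proof -
  have "s \<in> post_image M (layer M n)"
    if s: "s \<in> post_image M (reach_in M n)" and new: "\<forall>j\<le>n. s \<notin> reach_in M j" for s
  proof -
    obtain t where t: "t \<in> reach_in M n" "(t, s) \<in> trel M" and "s \<in> states M"
      using s by (auto simp: post_image_def)
    have "t \<notin> reach_in M j" if "j < n" for j
    proof
      assume "t \<in> reach_in M j"
      then have "s \<in> reach_in M (Suc j)"
        using t \<open>s \<in> states M\<close> by (auto simp: reach_in_Suc post_image_def)
      then show False
        using new that by auto
    qed
    then show ?thesis
      using t \<open>s \<in> states M\<close> by (auto simp: post_image_def layer_def)
  qed
  moreover have "post_image M (layer M n) \<subseteq> post_image M (reach_in M n)"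
    by (rule post_image_mono) (auto simp: layer_def)
  ultimately show ?thesis
    by (auto simp: layer_def[of M "Suc n"] reach_in_Suc less_Suc_eq_le)
qed

text \<open>One image step raises each index below \<open>m\<close> to at most \<open>m\<close>, and
  by assumption index \<open>m\<close> adds nothing. So the union is closed under images.\<close>

lemma reach_in_stable:
  assumes "(\<Union>j<m. reach_in M j) = (\<Union>j\<le>m. reach_in M j)"
  shows "reach_in M n \<subseteq> (\<Union>j<m. reach_in M j)"
proof (induction n)
  case 0
  show ?case
    \<comment> \<open>With the bound \<open>j \<le> m\<close>, index 0 is in range even for
      \<open>m = 0\<close>.\<close>
    unfolding assms by (rule UN_upper) simp
next
  case (Suc n)
  have "reach_in M (Suc n) \<subseteq> (\<Union>j<m. reach_in M (Suc j))"
    using post_image_mono[OF Suc.IH, of M] by (simp add: reach_in_Suc post_image_UN)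
  also have "\<dots> \<subseteq> (\<Union>j\<le>m. reach_in M j)"
    by (auto intro: Suc_leI)
  finally show ?case
    unfolding assms .
qed

lemma state_space_generation_layers:
  assumes fin: "finite (states M)" and init: "inits M \<subseteq> states M"
  obtains Sstar nxt m where "state_space_generation M = Some (Sstar, nxt, m)"
    and "\<forall>j\<le>m. nxt j = layer M j"
    and "\<forall>n. reach_in M n \<subseteq> (\<Union>j<m. reach_in M j)"
proof -
  \<comment> \<open>\<open>b\<close>, \<open>c\<close> and \<open>init_state\<close> copy the loop
    literally, so that unfolding them at the end yields the result of
    \<open>state_space_generation\<close>.\<close>
  define b :: "'a set \<times> (nat \<Rightarrow> 'a set) \<times> 'a set \<times> nat \<Rightarrow> bool"
    where "b = (\<lambda>(Sstar, nxt, q, i). Sstar \<noteq> q)"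
  define c :: "'a set \<times> (nat \<Rightarrow> 'a set) \<times> 'a set \<times> nat \<Rightarrow> _"
    where "c = (\<lambda>(Sstar, nxt, q, i).
             let i' = i + 1;
                 Sstar' = q;
                 nxt' = nxt(i' := post_image M (nxt (i' - 1)) - Sstar');
                 q' = Sstar' \<union> nxt' i'
             in (Sstar', nxt', q', i'))"
  define init_state :: "'a set \<times> (nat \<Rightarrow> 'a set) \<times> 'a set \<times> nat"
    where "init_state = ({}, (\<lambda>_. undefined)(0 := inits M), inits M, 0)"
  \<comment> \<open>The set \<open>Sstar\<close> lags one index behind \<open>q\<close>, so the exit
    condition \<open>Sstar = q\<close> is exactly the premise of
    \<open>reach_in_stable\<close>.\<close>
  define P where "P = (\<lambda>(Sstar, nxt, q, i). Sstar = (\<Union>j<i. reach_in M j) \<and>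
      q = (\<Union>j\<le>i. reach_in M j) \<and> (\<forall>j\<le>i. nxt j = layer M j))"
  \<comment> \<open>Termination measure: while the guard holds, the body replaces
    \<open>Sstar\<close> by the strictly larger \<open>q\<close>, inside a finite set.\<close>
  define f :: "'a set \<times> (nat \<Rightarrow> 'a set) \<times> 'a set \<times> nat \<Rightarrow> nat"
    where "f = (\<lambda>(Sstar, nxt, q, i). card (states M - Sstar))"
  have P_init: "P init_state"
    by (simp add: P_def init_state_def)
  have P_step: "P (c s)" if "P s" for s
  proof -
    obtain Sstar nxt q i where s: "s = (Sstar, nxt, q, i)"
      by (cases s)
    have q: "q = (\<Union>j\<le>i. reach_in M j)" and nxt: "\<forall>j\<le>i. nxt j = layer M j"
      using that by (simp_all add: P_def s)
    have new: "post_image M (nxt i) - q = layer M (Suc i)"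
      using q nxt by (simp add: layer_Suc)
    have "q \<union> layer M (Suc i) = (\<Union>j\<le>Suc i. reach_in M j)"
      unfolding q layer_def by (auto simp: atMost_Suc less_Suc_eq_le)
    then show ?thesis
      using q nxt new by (auto simp: P_def c_def s Let_def lessThan_Suc_atMost le_Suc_eq)
  qed
  have f_step: "f (c s) < f s" if "P s" "b s" for s
  proof -
    obtain Sstar nxt q i where s: "s = (Sstar, nxt, q, i)"
      by (cases s)
    have "Sstar \<subseteq> q" "q \<subseteq> states M" "Sstar \<noteq> q"
      using that reach_in_subset_states[OF init] by (fastforce simp: P_def b_def s)+
    then have "states M - q \<subset> states M - Sstar"
      by blast
    then show ?thesis
      using fin by (simp add: f_def c_def s Let_def psubset_card_mono)
  qed
  obtain t where t: "while_option b c init_state = Some t"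
    using measure_while_option_Some[of P b c f init_state] P_init P_step f_step by blast
  have "P t"
    using while_option_rule[of P b c, OF _ t P_init] P_step by blast
  moreover have "\<not> b t"
    using while_option_stop[OF t] .
  moreover obtain Sstar nxt q m where tt: "t = (Sstar, nxt, q, m)"
    by (cases t)
  ultimately have "(\<Union>j<m. reach_in M j) = (\<Union>j\<le>m. reach_in M j)" and "\<forall>j\<le>m. nxt j = layer M j"
    by (simp_all add: P_def b_def)
  moreover have "state_space_generation M = Some (Sstar, nxt, m)"
    unfolding state_space_generation_def t[unfolded b_def c_def init_state_def tt] by simp
  ultimately show thesis
    using that[of Sstar nxt m] reach_in_stable[of M m] by simp
qed

text \<open>This gives the lower bound for minimality. The induction appends at the end because
  \<open>reach_in\<close> grows by one image at the end; a list of \<open>n + 1\<close> states makes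
  \<open>n\<close> steps.\<close>

lemma last_trace_in_reach_in:
  assumes "trace_to M G xs"
  shows "last xs \<in> reach_in M (length xs - 1)"
proof -
  have "xs \<noteq> []" "set xs \<subseteq> states M" "hd xs \<in> inits M" "successively (\<lambda>s s'. (s, s') \<in> trel M) xs"
    using assms by (auto simp: trace_to_def)
  then show ?thesis
  proof (induction xs rule: rev_nonempty_induct)
    case (snoc x xs)
    then have "last xs \<in> reach_in M (length xs - 1)" "(last xs, x) \<in> trel M" "x \<in> states M"
      by (auto simp: successively_append_iff)
    then have "x \<in> reach_in M (Suc (length xs - 1))"
      by (auto simp: reach_in_Suc post_image_def)
    then show ?case
      using snoc.hyps by simp
  qed simp
qed

text \<open>Since \<open>post_image\<close> keeps only members of \<open>states M\<close>, the
  transitions have to stay inside \<open>states M\<close>.\<close>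

lemma reachable_in_reach_in:
  assumes "(s0, s) \<in> (trel M)\<^sup>*" "s0 \<in> inits M" "trel M \<subseteq> states M \<times> states M"
  shows "\<exists>n. s \<in> reach_in M n"
  using assms(1)
proof induction
  case base
  show ?case
    using assms(2) by (auto intro: exI[of _ 0])
next
  case (step t u)
  then obtain n where "t \<in> reach_in M n"
    by blast
  then have "u \<in> reach_in M (Suc n)"
    using step.hyps assms(3) by (auto simp: reach_in_Suc post_image_def)
  then show ?case ..
qed

text \<open>Each choice prepends a predecessor and lowers the index by one; at \<open>j = 0\<close>
  the list has \<open>k + 1\<close> states and starts in \<open>nxt 0\<close>.\<close>

lemma backward_choice_trace:
  assumes "backward_choice M nxt G k j xs" and "\<forall>i\<le>k. nxt i \<subseteq> states M"
  shows "j \<le> k \<and> length xs = Suc (k - j) \<and> xs \<noteq> [] \<and> hd xs \<in> nxt j \<and> last xs \<in> G \<and>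
    set xs \<subseteq> states M \<and> successively (\<lambda>s s'. (s, s') \<in> trel M) xs"
  using assms by induction (auto, meson Suc_leD subsetD)

text \<open>A fact about breadth-first search in any finite transition system; for a Boolean
  evolution system, \<open>G\<close> becomes the set of states enabling both rules.\<close>

lemma first_layer_shortest_traces:
  assumes fin: "finite (states M)" and init: "inits M \<subseteq> states M"
    and trel: "trel M \<subseteq> states M \<times> states M"
    and reach: "\<exists>s0\<in>inits M. \<exists>s\<in>G. (s0, s) \<in> (trel M)\<^sup>*"
  shows "\<exists>Sstar nxt m. state_space_generation M = Some (Sstar, nxt, m) \<and>
    nxt 0 = inits M \<and>
    (\<exists>k\<le>m. nxt k \<inter> G \<noteq> {} \<and> (\<forall>j<k. nxt j \<inter> G = {}) \<and>
       (\<forall>j xs. backward_choice M nxt G k (Suc j) xs \<longrightarrow> (\<exists>s'\<in>nxt j. (s', hd xs) \<in> trel M)) \<and>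
       (\<forall>xs. backward_choice M nxt G k 0 xs \<longrightarrow> length xs = k + 1 \<and> shortest_trace_to M G xs))"
proof -
  obtain Sstar nxt m where gen: "state_space_generation M = Some (Sstar, nxt, m)"
    and nxt: "\<forall>j\<le>m. nxt j = layer M j"
    and stable: "\<forall>n. reach_in M n \<subseteq> (\<Union>j<m. reach_in M j)"
    using state_space_generation_layers[OF fin init] .
  \<comment> \<open>Minimality is taken over \<open>reach_in\<close>, since this compares directly
    with arbitrary traces and makes sense beyond the last computed index \<open>m\<close>.\<close>
  define k where "k = (LEAST k. reach_in M k \<inter> G \<noteq> {})"
  obtain n where n: "reach_in M n \<inter> G \<noteq> {}"
    using reach reachable_in_reach_in[OF _ _ trel] by blast
  have k: "reach_in M k \<inter> G \<noteq> {}"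
    unfolding k_def using n by (rule LeastI)
  have k_le: "k \<le> j" if "reach_in M j \<inter> G \<noteq> {}" for j
    unfolding k_def using that by (rule Least_le)
  \<comment> \<open>By stability the state of \<open>G\<close> found at step \<open>k\<close>
    already occurs at an index below \<open>m\<close>, so \<open>nxt k\<close> is a computed
    layer.\<close>
  obtain j where "j < m" "reach_in M j \<inter> G \<noteq> {}"
    using k stable by blast
  then have "k \<le> m"
    using k_le by fastforce
  have below: "reach_in M j \<inter> G = {}" if "j < k" for j
    using k_le that by (meson not_le)
  have nxt_k: "nxt j = layer M j" if "j \<le> k" for j
    using nxt that \<open>k \<le> m\<close> by simp
  have sub: "\<forall>j\<le>k. nxt j \<subseteq> states M"
    using nxt_k reach_in_subset_states[OF init] by (auto simp: layer_def)
  \<comment> \<open>The earlier sets removed in forming the layer do not meet \<open>G\<close>, so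
    no state of \<open>G\<close> is lost.\<close>
  have meets: "nxt k \<inter> G \<noteq> {}"
    using k below by (fastforce simp: nxt_k layer_def)
  have avoids: "nxt j \<inter> G = {}" if "j < k" for j
    using below[OF that] that by (auto simp: nxt_k layer_def)
  have pred: "\<exists>s'\<in>nxt j. (s', hd xs) \<in> trel M" if "backward_choice M nxt G k (Suc j) xs" for j xs
    using backward_choice_trace[OF that sub] by (auto simp: nxt_k layer_Suc post_image_def)
  have "length xs = k + 1 \<and> shortest_trace_to M G xs" if "backward_choice M nxt G k 0 xs" for xs
  proof -
    have len: "length xs = k + 1" and "trace_to M G xs"
      using backward_choice_trace[OF that sub] by (simp_all add: trace_to_def nxt_k)
    moreover have "length xs \<le> length ys" if ys: "trace_to M G ys" for ys
    proof -
      have "last ys \<in> G" "ys \<noteq> []"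
        using ys by (auto simp: trace_to_def)
      \<comment> \<open>The endpoint of \<open>ys\<close> lies in \<open>G\<close> and is reached in
        \<open>length ys - 1\<close> steps, so \<open>k_le\<close> applies. Positivity rules out
        truncated subtraction.\<close>
      then have "k \<le> length ys - 1" "length ys > 0"
        using last_trace_in_reach_in[OF ys] k_le by auto
      then show ?thesis
        using len by linarith
    qed
    ultimately show ?thesis
      by (simp add: shortest_trace_to_def)
  qed
  moreover have "nxt 0 = inits M"
    using nxt by simp
  ultimately show ?thesis
    using gen \<open>k \<le> m\<close> meets avoids pred by blast
qed

lemma finite_valuations:
  assumes "finite (bes_vars E)"
  shows "finite (valuations E)"
  unfolding valuations_def using assms by (intro finite_PiE) auto

theorem theorem4:
  fixes E :: "'v bes"
    and M :: "('v valuation, 'p) transition_system"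
    and g1 g2 :: "'v bform" and a :: 'v
  assumes "boolean_evolution_system E"
    and "transition_system_of E M"
    and "Rule g1 a True \<in> bes_rules E"
    and "Rule g2 a False \<in> bes_rules E"
    and "\<exists>s0\<in>inits M. \<exists>s\<in>sat_states M g1 \<inter> sat_states M g2. (s0, s) \<in> (trel M)\<^sup>*"
  shows "\<exists>Sstar nxt m. state_space_generation M = Some (Sstar, nxt, m) \<and>
    nxt 0 = inits M \<and>
    (\<exists>k\<le>m.
       nxt k \<inter> sat_states M g1 \<inter> sat_states M g2 \<noteq> {} \<and>
       (\<forall>j<k. nxt j \<inter> sat_states M g1 \<inter> sat_states M g2 = {}) \<and>
       (\<forall>j xs. backward_choice M nxt (sat_states M g1 \<inter> sat_states M g2) k (Suc j) xs \<longrightarrow>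
          (\<exists>s'\<in>nxt j. (s', hd xs) \<in> trel M)) \<and>
       (\<forall>xs. backward_choice M nxt (sat_states M g1 \<inter> sat_states M g2) k 0 xs \<longrightarrow>
          length xs = k + 1 \<and>
          shortest_trace_to M (sat_states M g1 \<inter> sat_states M g2) xs))"
proof -
  have "finite (states M)"
    using assms(1,2) by (auto simp: transition_system_of_def boolean_evolution_system_def bes_vars_def
        intro!: finite_valuations)
  moreover have "inits M \<subseteq> states M" "trel M \<subseteq> states M \<times> states M"
    using assms(2) by (auto simp: transition_system_of_def bes_transitions_def)
  \<comment> \<open>Reassociating the intersections matches the goal with \<open>G\<close> taken as
    \<open>sat_states M g1 \<inter> sat_states M g2\<close>.\<close>
  ultimately show ?thesis
    using first_layer_shortest_traces[OF _ _ _ assms(5)] by (simp only: Int_assoc)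
qed

end
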